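(* Let $W\ge 1$ be an integer and $0<\varepsilon<1$ be such that $W\varepsilon^{-1}=2^L$ for an integer $L$. Consider a window consisting of the last $W$ items $x_{n-W+1},\dots,x_n$ of a stream over a universe of IDs, and let $h$ be a random fingerprint function mapping IDs to $\{0,1,\dots,2^L-1\}$ such that the fingerprints of distinct IDs are independent and uniformly distributed. For an ID $y$, let $f^W_y$ be the number of positions $i\in\{n-W+1,\dots,n\}$ with $x_i=y$, and let $\widehat{f^W_y}$ be the number of positions $i\in\{n-W+1,\dots,n\}$ with $h(x_i)=h(y)$ (this is the value returned by the algorithm's FREQUENCY query). Then for every ID $y$, $\widehat{f^W_y}\ge f^W_y$ always, and $\Pr\left[f^W_y=\widehat{f^W_y}\right]\ge 1-\varepsilon$.
   Context: This models the SWAMP algorithm: it stores the $L$-bit fingerprints of the last $W$ stream items in a cyclic buffer and keeps, in a compact table, the number of occurrences of each fingerprint within the window; FREQUENCY$(y)$ returns the stored count of fingerprint $h(y)$. *)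

theory Defs
  imports "HOL-Probability.Probability"
begin

text \<open>The stream is \<open>x 1, x 2, \<dots>\<close>; the value \<open>x 0\<close> is never inspected. Natural-number
  subtraction is truncated, so this is the window of the last \<open>W\<close> items only if \<open>W \<le> n\<close>.\<close>

definition window :: "nat \<Rightarrow> nat \<Rightarrow> nat set" where
  "window W n = {n - W + 1..n}"

definition freq :: "nat \<Rightarrow> nat \<Rightarrow> (nat \<Rightarrow> 'id) \<Rightarrow> 'id \<Rightarrow> nat" where
  "freq W n x y = card {i \<in> window W n. x i = y}"

definition freq_est :: "nat \<Rightarrow> nat \<Rightarrow> ('id \<Rightarrow> nat) \<Rightarrow> (nat \<Rightarrow> 'id) \<Rightarrow> 'id \<Rightarrow> nat" where
  "freq_est W n g x y = card {i \<in> window W n. g (x i) = g y}"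

text \<open>\<open>h u \<omega>\<close> is the \<open>L\<close>-bit fingerprint of the ID \<open>u\<close> at outcome \<open>\<omega>\<close>. The predicate
  \<open>indep_vars\<close> includes measurability of each \<open>h u\<close> into \<open>count_space {0..2 ^ L - 1}\<close>, so all
  fingerprints lie in \<open>{0..2 ^ L - 1}\<close> at every outcome in \<open>space M\<close>.\<close>

definition random_fingerprint :: "'w measure \<Rightarrow> nat \<Rightarrow> ('id \<Rightarrow> 'w \<Rightarrow> nat) \<Rightarrow> bool" where
  "random_fingerprint M L h \<longleftrightarrow>
     prob_space M \<and>
     prob_space.indep_vars M (\<lambda>_. count_space {0..2 ^ L - 1}) h UNIV \<and>
     (\<forall>u. distr M (count_space {0..2 ^ L - 1}) (h u) = uniform_count_measure {0..2 ^ L - 1})"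

end

theory Submission imports Defs begin

text \<open>The estimate exceeds the true frequency only if some window item other than \<open>y\<close> collides
  with \<open>y\<close>. There are at most \<open>W\<close> such IDs and each collides with probability \<open>1 / 2 ^ L = \<epsilon> / W\<close>,
  so the union bound gives failure probability at most \<open>\<epsilon>\<close>.\<close>

lemma freq_le_freq_est: "freq W n x y \<le> freq_est W n g x y"
  unfolding freq_def freq_est_def window_def by (rule card_mono) auto

text \<open>The positions holding \<open>y\<close> are among those whose fingerprint matches that of
  \<open>y\<close>, and nested finite sets have equal cardinality only if they coincide. This turns
  exactness of the estimate into the absence of collisions over a finite set of IDs.\<close>

lemma freq_eq_freq_est_iff:
  "freq W n x y = freq_est W n g x y \<longleftrightarrow> (\<forall>u \<in> x ` window W n - {y}. g u \<noteq> g y)"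
proof -
  let ?F = "{i \<in> window W n. x i = y}" and ?G = "{i \<in> window W n. g (x i) = g y}"
  have "finite ?G" "?F \<subseteq> ?G"
    by (auto simp: window_def)
  then have "card ?F = card ?G \<longleftrightarrow> ?F = ?G"
    by (auto dest: card_subset_eq)
  also have "\<dots> \<longleftrightarrow> (\<forall>u \<in> x ` window W n - {y}. g u \<noteq> g y)"
    by auto
  finally show ?thesis
    by (simp add: freq_def freq_est_def)
qed

text \<open>Split by the common value: two independent uniform fingerprints both equal a given
  \<open>v\<close> with probability \<open>1 / 2 ^ L\<close> squared, and there are
  \<open>2 ^ L\<close> disjoint cases.\<close>

lemma random_fingerprint_collision:
  fixes h :: "'id \<Rightarrow> 'w \<Rightarrow> nat"
  assumes h: "random_fingerprint M L h" and "u \<noteq> y"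
  shows "{\<omega> \<in> space M. h u \<omega> = h y \<omega>} \<in> sets M"
    and "measure M {\<omega> \<in> space M. h u \<omega> = h y \<omega>} = 1 / 2 ^ L"
proof -
  interpret prob_space M
    using h by (simp add: random_fingerprint_def)
  define V :: "nat set" where "V = {0..2 ^ L - 1}"
  define E where "E z v = h z -` {v} \<inter> space M" for z v
  have card_V: "card V = 2 ^ L"
    by (simp add: V_def)
  have fin: "finite V" and ne: "V \<noteq> {}"
    by (simp_all add: V_def)
  have indep: "indep_vars (\<lambda>_. count_space V) h UNIV"
    and distr: "distr M (count_space V) (h z) = uniform_count_measure V" for z
    using h by (simp_all add: random_fingerprint_def V_def)
  have meas[measurable]: "h z \<in> measurable M (count_space V)" for z
    using indep by (simp add: indep_vars_def)
  have sets_E: "E z v \<in> events" if "v \<in> V" for z v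
    unfolding E_def using that by (intro measurable_sets[OF meas]) auto
  have prob_E: "prob (E z v) = 1 / 2 ^ L" if "v \<in> V" for z v
  proof -
    have "prob (E z v) = measure (distr M (count_space V) (h z)) {v}"
      unfolding E_def using that by (intro measure_distr[symmetric]) auto
    also have "\<dots> = 1 / 2 ^ L"
      unfolding distr using that fin
      by (simp add: measure_uniform_count_measure card_V)
    finally show ?thesis .
  qed
  have prob_both: "prob (E u v \<inter> E y v) = 1 / 2 ^ L * (1 / 2 ^ L)" if "v \<in> V" for v
  proof -
    \<comment> \<open>Independence is applied to the index set \<open>{u, y}\<close>; as
      \<open>u \<noteq> y\<close>, the product has two genuine factors.\<close>
    have "prob (\<Inter>z\<in>{u, y}. h z -` {v} \<inter> space M) = (\<Prod>z\<in>{u, y}. prob (h z -` {v} \<inter> space M))"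
      using that by (intro indep_varsD[OF indep]) auto
    then show ?thesis
      using that \<open>u \<noteq> y\<close> prob_E by (simp add: E_def)
  qed
  \<comment> \<open>The union covers every collision because measurability into
    \<open>count_space V\<close> forces all fingerprints into \<open>V\<close>.\<close>
  have coll: "{\<omega> \<in> space M. h u \<omega> = h y \<omega>} = (\<Union>v\<in>V. E u v \<inter> E y v)"
    using measurable_space[OF meas] by (auto simp: E_def)
  show "{\<omega> \<in> space M. h u \<omega> = h y \<omega>} \<in> events"
    unfolding coll using fin sets_E by blast
  have "prob (\<Union>v\<in>V. E u v \<inter> E y v) = (\<Sum>v\<in>V. prob (E u v \<inter> E y v))"
    using fin sets_E by (intro finite_measure_finite_Union) (auto simp: disjoint_family_on_def E_def)
  also have "\<dots> = 1 / 2 ^ L"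
    by (simp add: prob_both card_V)
  finally show "prob {\<omega> \<in> space M. h u \<omega> = h y \<omega>} = 1 / 2 ^ L"
    unfolding coll .
qed

theorem theorem2:
  fixes W L n :: nat and \<epsilon> :: real
    and x :: "nat \<Rightarrow> 'id" and y :: 'id
    and M :: "'w measure" and h :: "'id \<Rightarrow> 'w \<Rightarrow> nat"
  assumes "W \<ge> 1"
    and "0 < \<epsilon>" and "\<epsilon> < 1"
    and "real W * inverse \<epsilon> = 2 ^ L"
    and "W \<le> n"
    and "random_fingerprint M L h"
  shows "(\<forall>\<omega>\<in>space M. freq_est W n (\<lambda>u. h u \<omega>) x y \<ge> freq W n x y) \<and>
         measure M {\<omega> \<in> space M. freq W n x y = freq_est W n (\<lambda>u. h u \<omega>) x y} \<ge> 1 - \<epsilon>"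
proof
  show "\<forall>\<omega>\<in>space M. freq_est W n (\<lambda>u. h u \<omega>) x y \<ge> freq W n x y"
    by (simp add: freq_le_freq_est)
next
  interpret prob_space M
    using assms(6) by (simp add: random_fingerprint_def)
  \<comment> \<open>\<open>y\<close> is removed because it always collides with itself; taking the
    image counts a repeated ID once.\<close>
  define S where "S = x ` window W n - {y}"
  define C where "C u = {\<omega> \<in> space M. h u \<omega> = h y \<omega>}" for u
  let ?good = "{\<omega> \<in> space M. freq W n x y = freq_est W n (\<lambda>u. h u \<omega>) x y}"
  have fin_S: "finite S"
    by (simp add: S_def window_def)
  have "card S \<le> card (x ` window W n)"
    unfolding S_def by (rule card_mono) (auto simp: window_def)
  also have "\<dots> \<le> card (window W n)"
    by (rule card_image_le) (simp add: window_def)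
  \<comment> \<open>Since \<open>W \<le> n\<close>, the subtraction in \<open>window\<close> is not
    truncated.\<close>
  also have "\<dots> = W"
    using assms(5) by (simp add: window_def)
  finally have card_S: "card S \<le> W" .
  have C: "C u \<in> events" "prob (C u) = 1 / 2 ^ L" if "u \<noteq> y" for u
    using random_fingerprint_collision[OF assms(6) that] by (simp_all add: C_def)
  have C_S: "C ` S \<subseteq> events"
    using C(1) by (auto simp: S_def)
  have "prob (\<Union>u\<in>S. C u) \<le> (\<Sum>u\<in>S. prob (C u))"
    using fin_S C_S by (rule finite_measure_subadditive_finite)
  also have "\<dots> = real (card S) / 2 ^ L"
    using C(2) by (simp add: S_def)
  also have "\<dots> \<le> real W / 2 ^ L"
    using card_S by (simp add: divide_right_mono)
  \<comment> \<open>Here \<open>2 ^ L\<close> is rewritten to \<open>W * inverse \<epsilon>\<close>,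
    and the nonzero \<open>W\<close> cancels.\<close>
  also have "\<dots> = \<epsilon>"
    using assms(1,2) by (simp add: inverse_eq_divide flip: assms(4))
  finally have "1 - \<epsilon> \<le> prob (space M - (\<Union>u\<in>S. C u))"
    using C_S fin_S by (subst prob_compl) auto
  also have "space M - (\<Union>u\<in>S. C u) = ?good"
    by (auto simp: freq_eq_freq_est_iff S_def C_def)
  finally show "prob ?good \<ge> 1 - \<epsilon>" .
qed

end
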